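(* The poset $P=2^{<\omega}\mathbin{\dot\cup}[0,1]$ (with the binary-expansion order defined in the context) is a quasicontinuous dcpo.
   Context: Let $T=2^{<\omega}$ be the set of finite binary words with the prefix order $\preccurlyeq$, and $X=2^\omega$ the set of infinite binary sequences. For $s\in T$, $[s]=\{\alpha\in X: s \text{ is a prefix of }\alpha\}$. Let $\pi:X\to[0,1]$, $\pi(\alpha)=\sum_{n=0}^\infty \alpha(n)/2^{n+1}$. The poset $P=T\mathbin{\dot\cup}[0,1]$ (disjoint union) is ordered by: for $s,t\in T$, $s\le t$ iff $s\preccurlyeq t$; for $s\in T$, $r\in[0,1]$, $s\le r$ iff $r\in\pi([s])$; for $r,q\in[0,1]$, $r\le q$ iff $r=q$; no other comparabilities. A dcpo is a poset in which every nonempty directed subset has a supremum. $\uparrow A=\{p\in P:\exists a\in A,\ a\le p\}$, $\uparrow x=\uparrow\{x\}$. For $A\subseteq P$ and $x\in P$, $A\ll x$ means: for every (nonempty) directed $D\subseteq P$, $\bigvee D\in\uparrow x$ implies $D\cap\uparrow A\ne\varnothing$. A family of sets is filtered under inclusion if it is nonempty and any two members contain a common member. A dcpo $P$ is quasicontinuous if for every $x\in P$ the family $\{\uparrow F: F\subseteq P\text{ finite}, F\ll x\}$ is filtered under inclusion and has intersection $\uparrow x$. *)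

theory Defs
  imports Complex_Main "HOL-Library.Sublist" "HOL-Algebra.Order"
begin

section \<open>Quasicontinuous dcpos\<close>

text \<open>
  Posets are the structures \<open>partial_order L\<close> of HOL-Algebra, on \<open>carrier L\<close>; suprema are
  expressed by \<open>is_lub L x D\<close> (\<open>x\<close> is a least upper bound of \<open>D\<close> in \<open>L\<close>).
\<close>

definition directed_in :: "('a, 'b) gorder_scheme \<Rightarrow> 'a set \<Rightarrow> bool" where
  "directed_in L D \<longleftrightarrow> D \<subseteq> carrier L \<and> D \<noteq> {} \<and>
     (\<forall>x\<in>D. \<forall>y\<in>D. \<exists>z\<in>D. x \<sqsubseteq>\<^bsub>L\<^esub> z \<and> y \<sqsubseteq>\<^bsub>L\<^esub> z)"

definition dcpo :: "('a, 'b) gorder_scheme \<Rightarrow> bool" where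
  "dcpo L \<longleftrightarrow> partial_order L \<and> (\<forall>D. directed_in L D \<longrightarrow> (\<exists>x. is_lub L x D))"

definition up_set :: "('a, 'b) gorder_scheme \<Rightarrow> 'a set \<Rightarrow> 'a set" where
  "up_set L A = {p \<in> carrier L. \<exists>a\<in>A. a \<sqsubseteq>\<^bsub>L\<^esub> p}"

definition way_below :: "('a, 'b) gorder_scheme \<Rightarrow> 'a set \<Rightarrow> 'a \<Rightarrow> bool" where
  "way_below L A x \<longleftrightarrow>
     (\<forall>D s. directed_in L D \<and> is_lub L s D \<and> s \<in> up_set L {x} \<longrightarrow> D \<inter> up_set L A \<noteq> {})"

definition filtered_family :: "'a set set \<Rightarrow> bool" where
  "filtered_family \<F> \<longleftrightarrow> \<F> \<noteq> {} \<and> (\<forall>A\<in>\<F>. \<forall>B\<in>\<F>. \<exists>C\<in>\<F>. C \<subseteq> A \<inter> B)"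

definition fin_way_below :: "('a, 'b) gorder_scheme \<Rightarrow> 'a \<Rightarrow> 'a set set" where
  "fin_way_below L x = {up_set L F | F. F \<subseteq> carrier L \<and> finite F \<and> way_below L F x}"

definition quasicontinuous_dcpo :: "('a, 'b) gorder_scheme \<Rightarrow> bool" where
  "quasicontinuous_dcpo L \<longleftrightarrow> dcpo L \<and>
     (\<forall>x\<in>carrier L. filtered_family (fin_way_below L x) \<and> \<Inter> (fin_way_below L x) = up_set L {x})"

section \<open>The binary-expansion poset\<close>

text \<open>
  Finite binary words are of type \<open>bool list\<close>, infinite binary sequences of type
  \<open>nat \<Rightarrow> bool\<close>; \<open>True\<close> is the digit 1.
\<close>

definition cylinder :: "bool list \<Rightarrow> (nat \<Rightarrow> bool) set" where
  "cylinder s = {\<alpha>. \<forall>i<length s. s ! i = \<alpha> i}"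

definition bin_val :: "(nat \<Rightarrow> bool) \<Rightarrow> real" where
  "bin_val \<alpha> = (\<Sum>n. of_bool (\<alpha> n) / 2 ^ (n + 1))"

fun bin_le :: "bool list + real \<Rightarrow> bool list + real \<Rightarrow> bool" where
  "bin_le (Inl s) (Inl t) \<longleftrightarrow> prefix s t"
| "bin_le (Inl s) (Inr r) \<longleftrightarrow> r \<in> bin_val ` cylinder s"
| "bin_le (Inr r) (Inr q) \<longleftrightarrow> r = q"
| "bin_le (Inr r) (Inl s) \<longleftrightarrow> False"

definition bin_poset :: "(bool list + real) gorder" where
  "bin_poset = \<lparr>carrier = UNIV <+> {0..1}, eq = (=), le = bin_le\<rparr>"

end

theory Submission
  imports Defs
begin

text \<open>
  Finite words cannot approximate a point \<open>x\<close> one at a time, because a dyadic rational has two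
  expansions; but the set consisting of \<open>x\<close> (if it is a word) and of the \<open>n\<close>-th truncations of all
  expansions of all reals above \<open>x\<close> is finite and way below \<open>x\<close>. Any finite set \<open>F\<close> way below \<open>x\<close>
  contains a prefix of each such expansion, so its up-set contains these sets once \<open>n\<close> exceeds the
  lengths of the words in \<open>F\<close>. Their up-sets shrink to that of \<open>x\<close>, because the
  reals above a word of length \<open>k\<close> form a compact interval of length \<open>1 / 2 ^ k\<close>.
\<close>

section \<open>Binary expansions\<close>

definition trunc :: "(nat \<Rightarrow> 'a) \<Rightarrow> nat \<Rightarrow> 'a list" where
  "trunc \<alpha> n = map \<alpha> [0..<n]"

lemma length_trunc [simp]: "length (trunc \<alpha> n) = n"
  by (simp add: trunc_def)

lemma nth_trunc [simp]: "i < n \<Longrightarrow> trunc \<alpha> n ! i = \<alpha> i"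
  by (simp add: trunc_def)

lemma prefix_iff_nth:
  "prefix s t \<longleftrightarrow> length s \<le> length t \<and> (\<forall>i<length s. s ! i = t ! i)"
proof
  assume "prefix s t"
  then show "length s \<le> length t \<and> (\<forall>i<length s. s ! i = t ! i)"
    by (auto simp: prefix_def nth_append)
next
  assume "length s \<le> length t \<and> (\<forall>i<length s. s ! i = t ! i)"
  then have "s = take (length s) t"
    by (intro nth_equalityI) auto
  then show "prefix s t"
    by (metis take_is_prefix)
qed

lemma prefix_trunc_trunc: "m \<le> n \<Longrightarrow> prefix (trunc \<alpha> m) (trunc \<alpha> n)"
  by (simp add: prefix_iff_nth)

lemma cylinder_eq: "cylinder s = {\<alpha>. s = trunc \<alpha> (length s)}"
  by (auto simp: cylinder_def list_eq_iff_nth_eq)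

lemma cylinder_antimono: "prefix s t \<Longrightarrow> cylinder t \<subseteq> cylinder s"
  by (force simp: cylinder_def prefix_iff_nth)

lemma trunc_in_cylinder [simp]: "\<alpha> \<in> cylinder (trunc \<alpha> n)"
  by (simp add: cylinder_eq)

lemma cylinder_Nil [simp]: "cylinder [] = UNIV"
  by (simp add: cylinder_def)

text \<open>\<open>case_nat b\<close> prepends the digit \<open>b\<close> to a sequence; this form
  lets images of cylinders be computed by induction on the word.\<close>

lemma cylinder_Cons: "cylinder (b # s) = case_nat b ` cylinder s"
proof (intro equalityI subsetI)
  fix \<alpha> assume "\<alpha> \<in> cylinder (b # s)"
  then have "\<alpha> 0 = b" "\<alpha> \<circ> Suc \<in> cylinder s"
    by (auto simp: cylinder_def nth_Cons split: nat.splits)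
  moreover have "\<alpha> = case_nat (\<alpha> 0) (\<alpha> \<circ> Suc)"
    by (auto simp: fun_eq_iff split: nat.splits)
  ultimately show "\<alpha> \<in> case_nat b ` cylinder s"
    by blast
qed (auto simp: cylinder_def nth_Cons split: nat.splits)

section \<open>Values of binary expansions and images of cylinders\<close>

lemma sums_half_powers: "(\<lambda>n. 1 / 2 ^ (n + 1) :: real) sums 1"
  using power_half_series by (simp add: power_divide)

lemma summable_bin_val: "summable (\<lambda>n. of_bool (\<alpha> n) / 2 ^ (n + 1) :: real)"
  by (rule summable_comparison_test'[OF sums_summable[OF sums_half_powers]]) auto

lemma bin_val_range: "bin_val \<alpha> \<in> {0..1}"
proof -
  have "bin_val \<alpha> \<le> (\<Sum>n. 1 / 2 ^ (n + 1))"
    unfolding bin_val_def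
    by (intro suminf_le summable_bin_val sums_summable[OF sums_half_powers]) (auto simp: divide_right_mono)
  moreover have "0 \<le> bin_val \<alpha>"
    unfolding bin_val_def by (intro suminf_nonneg summable_bin_val) auto
  ultimately show ?thesis
    using sums_unique[OF sums_half_powers] by simp
qed

text \<open>Prepending a digit moves every other digit one place to the right, which halves its
  weight; the new digit has weight 1/2.\<close>

lemma bin_val_case_nat: "bin_val (case_nat b \<alpha>) = (of_bool b + bin_val \<alpha>) / 2"
proof -
  have "(\<Sum>n. of_bool (\<alpha> n) / 2 ^ (n + 2)) = bin_val \<alpha> / (2 :: real)"
    unfolding bin_val_def using suminf_divide[OF summable_bin_val, of \<alpha> 2]
    by (simp add: field_simps)
  then show ?thesis
    using suminf_split_head[OF summable_bin_val, of "case_nat b \<alpha>"]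
    by (simp add: bin_val_def add_divide_distrib algebra_simps)
qed

text \<open>Digits are produced by iterating the doubling map, starting at \<open>r\<close>.\<close>

lemma bin_val_surj:
  assumes "r \<in> {0..1}"
  shows "r \<in> range bin_val"
proof -
  \<comment> \<open>\<open>x n\<close> is the remainder after \<open>n\<close> digits, rescaled by
    \<open>2 ^ n\<close>. The digit at 1/2 is 1, so remainders never leave the unit interval; for
    \<open>r = 1\<close> all digits are 1.\<close>
  define x where "x = rec_nat r (\<lambda>_ y. 2 * y - of_bool (y \<ge> 1 / 2))"
  define \<alpha> where "\<alpha> n \<longleftrightarrow> x n \<ge> 1 / 2" for n
  have x_0: "x 0 = r" and x_Suc: "x (Suc n) = 2 * x n - of_bool (\<alpha> n)" for n
    by (simp_all add: x_def \<alpha>_def)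
  have x_range: "x n \<in> {0..1}" for n
    using assms by (induction n) (auto simp: x_0 x_Suc \<alpha>_def)
  have partial: "(\<Sum>k<n. of_bool (\<alpha> k) / 2 ^ (k + 1)) = r - x n / 2 ^ n" for n
    by (induction n) (auto simp: x_0 x_Suc field_simps)
  have "(\<lambda>n. x n / 2 ^ n) \<longlonglongrightarrow> 0"
  proof (rule tendsto_sandwich[of "\<lambda>_. 0" _ _ "\<lambda>n. (1 / 2) ^ n"])
    show "(\<lambda>n. (1 / 2 :: real) ^ n) \<longlonglongrightarrow> 0"
      by (rule LIMSEQ_power_zero) simp
  qed (use x_range in \<open>auto simp: power_divide divide_right_mono\<close>)
  then have "(\<lambda>n. r - x n / 2 ^ n) \<longlonglongrightarrow> r"
    using tendsto_diff[OF tendsto_const] by fastforce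
  then have "(\<lambda>k. of_bool (\<alpha> k) / 2 ^ (k + 1)) sums r"
    by (simp only: sums_def partial)
  then have "r = bin_val \<alpha>"
    unfolding bin_val_def by (rule sums_unique)
  then show ?thesis by simp
qed

text \<open>The empty word gives the whole unit interval, by surjectivity of \<open>bin_val\<close>;
  each prepended digit then acts by an affine map of ratio 1/2.\<close>

lemma bin_val_image_cylinder: "\<exists>a. bin_val ` cylinder s = {a..a + 1 / 2 ^ length s}"
proof (induction s)
  case Nil
  have "bin_val ` cylinder [] = {0..0 + 1 / 2 ^ length ([] :: bool list)}"
    using bin_val_range bin_val_surj by fastforce
  then show ?case ..
next
  case (Cons b s)
  then obtain a where a: "bin_val ` cylinder s = {a..a + 1 / 2 ^ length s}" ..
  have "bin_val ` cylinder (b # s) = (\<lambda>x. (of_bool b + x) / 2) ` bin_val ` cylinder s"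
    by (simp add: cylinder_Cons image_image bin_val_case_nat)
  also have "\<dots> = (\<lambda>x. (1 / 2) * x + of_bool b / 2) ` {a..a + 1 / 2 ^ length s}"
    by (simp add: a field_simps)
  also have "\<dots> = {a / 2 + of_bool b / 2..a / 2 + of_bool b / 2 + 1 / 2 ^ length (b # s)}"
    by (subst image_affinity_atLeastAtMost) (auto simp: field_simps)
  finally show ?case by blast
qed

lemma bin_val_cylinder_dist:
  assumes "\<alpha> \<in> cylinder s" "\<beta> \<in> cylinder s"
  shows "\<bar>bin_val \<alpha> - bin_val \<beta>\<bar> \<le> 1 / 2 ^ length s"
proof -
  obtain a where "bin_val ` cylinder s = {a..a + 1 / 2 ^ length s}"
    using bin_val_image_cylinder by blast
  then have "bin_val \<alpha> \<in> {a..a + 1 / 2 ^ length s}" "bin_val \<beta> \<in> {a..a + 1 / 2 ^ length s}"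
    using assms by blast+
  then show ?thesis by auto
qed

lemma closed_bin_val_image_cylinder: "closed (bin_val ` cylinder s)"
  by (metis bin_val_image_cylinder closed_atLeastAtMost)

lemma half_power_less: "0 < e \<Longrightarrow> \<exists>n. 1 / 2 ^ n < (e :: real)"
  using real_arch_pow_inv[of e "1 / 2"] by (simp add: power_divide)

section \<open>Directed sets in the binary-expansion poset\<close>

lemma bin_poset_sel [simp]:
  "carrier bin_poset = UNIV <+> {0..1}" "le bin_poset = bin_le" "eq bin_poset = (=)"
  by (simp_all add: bin_poset_def)

lemma bin_le_refl [simp]: "bin_le x x"
  by (cases x) auto

lemma bin_le_trans:
  assumes "bin_le x y" "bin_le y z"
  shows "bin_le x z"
proof (cases z)
  case (Inl u)
  with assms show ?thesis by (cases x; cases y) auto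
next
  case (Inr r)
  with assms show ?thesis by (cases x; cases y) (auto dest: cylinder_antimono)
qed

lemma bin_le_antisym: "bin_le x y \<Longrightarrow> bin_le y x \<Longrightarrow> x = y"
  by (cases x; cases y) auto

lemma partial_order_bin_poset: "partial_order bin_poset"
  by unfold_locales (auto intro: bin_le_trans bin_le_antisym)

section \<open>Suprema of directed sets\<close>

lemma is_lub_bin_poset_unique:
  "is_lub bin_poset x D \<Longrightarrow> is_lub bin_poset y D \<Longrightarrow> x = y"
  unfolding least_def by (auto intro: bin_le_antisym)

lemma is_lub_bin_poset_iff:
  assumes "D \<subseteq> carrier bin_poset"
  shows "is_lub bin_poset p D \<longleftrightarrow> p \<in> carrier bin_poset \<and> (\<forall>d\<in>D. bin_le d p) \<and>
    (\<forall>y\<in>carrier bin_poset. (\<forall>d\<in>D. bin_le d y) \<longrightarrow> bin_le p y)"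
  using assms unfolding least_def Upper_def bin_poset_sel(2) by blast

lemma is_lub_greatest:
  assumes "D \<subseteq> carrier bin_poset" "p \<in> D" "\<forall>d\<in>D. bin_le d p"
  shows "is_lub bin_poset p D"
  using assms by (auto simp only: is_lub_bin_poset_iff)

lemma directed_singleton: "x \<in> carrier bin_poset \<Longrightarrow> directed_in bin_poset {x}"
  by (simp add: directed_in_def)

lemma bin_val_carrier [simp]: "Inr (bin_val \<alpha>) \<in> carrier bin_poset"
  using bin_val_range[of \<alpha>] by auto

text \<open>No word has prefixes of unbounded length, and a real above arbitrarily long truncations
  of \<alpha> lies in arbitrarily short intervals around \<open>bin_val \<alpha>\<close>.
  \<open>D\<close> may omit some truncations, because a directed set without greatest element need
  not contain all of them.\<close>

lemma is_lub_truncs: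
  assumes sub: "D \<subseteq> range (\<lambda>n. Inl (trunc \<alpha> n))"
    and unb: "\<forall>n. \<exists>k\<ge>n. Inl (trunc \<alpha> k) \<in> D"
  shows "is_lub bin_poset (Inr (bin_val \<alpha>)) D"
proof -
  have "bin_le (Inr (bin_val \<alpha>)) y" if y: "\<forall>d\<in>D. bin_le d y" for y
  proof (cases y)
    case (Inl t)
    \<comment> \<open>The successor makes the truncation strictly longer than \<open>t\<close>,
      hence no prefix of it.\<close>
    obtain k where "k \<ge> Suc (length t)" "Inl (trunc \<alpha> k) \<in> D"
      using unb by blast
    then have "length (trunc \<alpha> k) \<le> length t"
      using y Inl by (force dest: prefix_length_le)
    with \<open>k \<ge> Suc (length t)\<close> show ?thesis by simp
  next
    case (Inr q)
    have "\<bar>q - bin_val \<alpha>\<bar> \<le> e" if "e > 0" for e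
    proof -
      obtain n where n: "1 / 2 ^ n < e" using half_power_less[OF \<open>e > 0\<close>] by blast
      obtain k where k: "k \<ge> n" "Inl (trunc \<alpha> k) \<in> D" using unb by blast
      then have "bin_le (Inl (trunc \<alpha> k)) (Inr q)" using y Inr by blast
      then obtain \<beta> where "\<beta> \<in> cylinder (trunc \<alpha> k)" "q = bin_val \<beta>" by auto
      then have "\<bar>q - bin_val \<alpha>\<bar> \<le> 1 / 2 ^ k"
        using bin_val_cylinder_dist[of \<beta> "trunc \<alpha> k" \<alpha>] by simp
      also have "\<dots> \<le> 1 / 2 ^ n"
        using k(1) by (simp add: frac_le)
      finally show ?thesis using n by simp
    qed
    then have "\<bar>q - bin_val \<alpha>\<bar> \<le> 0" by (rule field_le_epsilon) simp
    with Inr show ?thesis by simp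
  qed
  moreover have "bin_le d (Inr (bin_val \<alpha>))" if "d \<in> D" for d
    using that sub by auto
  moreover have "D \<subseteq> carrier bin_poset" using sub by auto
  ultimately show ?thesis
    using bin_val_carrier by (simp only: is_lub_bin_poset_iff) blast
qed

text \<open>Reals are maximal, so a real in a directed set is its greatest element. Without a
  greatest element the set therefore consists of words; these agree on common positions and have
  unbounded length, so they trace out a single infinite sequence.\<close>

lemma directed_cases:
  assumes "directed_in bin_poset D"
  obtains (greatest) p where "p \<in> D" "\<forall>d\<in>D. bin_le d p"
  | (branch) \<alpha> where "D \<subseteq> range (\<lambda>n. Inl (trunc \<alpha> n))" "\<forall>n. \<exists>k\<ge>n. Inl (trunc \<alpha> k) \<in> D"
proof -
  have dir: "\<exists>z\<in>D. bin_le x z \<and> bin_le y z" if "x \<in> D" "y \<in> D" for x y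
    using assms that by (auto simp: directed_in_def)
  have "D \<noteq> {}" using assms by (auto simp: directed_in_def)
  show thesis
  proof (cases "\<exists>p\<in>D. \<forall>d\<in>D. bin_le d p")
    case True
    then show ?thesis using greatest by blast
  next
    case no_greatest: False
    have words: "\<exists>s. x = Inl s" if "x \<in> D" for x
    proof (cases x)
      case (Inr r)
      have "bin_le d x" if "d \<in> D" for d
      proof -
        obtain z where "z \<in> D" "bin_le x z" "bin_le d z" using dir \<open>x \<in> D\<close> \<open>d \<in> D\<close> by blast
        then show ?thesis using Inr by (cases z) auto
      qed
      then show ?thesis using no_greatest \<open>x \<in> D\<close> by blast
    qed auto
    have agree: "s ! i = t ! i" if "Inl s \<in> D" "Inl t \<in> D" "i < length s" "i < length t" for s t i
    proof -
      obtain z where "z \<in> D" "bin_le (Inl s) z" "bin_le (Inl t) z" using dir \<open>Inl s \<in> D\<close> \<open>Inl t \<in> D\<close> by blast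
      then show ?thesis using words[of z] that by (auto simp: prefix_iff_nth)
    qed
    have longer: "\<exists>t. Inl t \<in> D \<and> length t > length s" if "Inl s \<in> D" for s
    proof -
      obtain d where "d \<in> D" "\<not> bin_le d (Inl s)" using no_greatest \<open>Inl s \<in> D\<close> by blast
      obtain z where "z \<in> D" "bin_le (Inl s) z" "bin_le d z" using dir \<open>Inl s \<in> D\<close> \<open>d \<in> D\<close> by blast
      obtain t where t: "z = Inl t" using words \<open>z \<in> D\<close> by blast
      have "prefix s t" "s \<noteq> t"
        using \<open>bin_le (Inl s) z\<close> \<open>bin_le d z\<close> \<open>\<not> bin_le d (Inl s)\<close> t by auto
      then have "length s < length t"
        by (simp add: prefix_length_less strict_prefix_def)
      with t \<open>z \<in> D\<close> show ?thesis by blast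
    qed
    have unb: "\<exists>t. Inl t \<in> D \<and> length t \<ge> n" for n
    proof (induction n)
      case 0
      then show ?case using \<open>D \<noteq> {}\<close> words by fastforce
    next
      case (Suc n)
      then show ?case using longer by (metis Suc_leI le_less_trans)
    qed
    then obtain w where w: "Inl (w n) \<in> D" "length (w n) \<ge> n" for n by metis
    \<comment> \<open>\<open>w (Suc i)\<close> has length at least \<open>Suc i\<close>, so position
      \<open>i\<close> exists; by \<open>agree\<close> any other word of \<open>D\<close> that is
      long enough would give the same digit.\<close>
    define \<alpha> where "\<alpha> i = w (Suc i) ! i" for i
    have eq: "s = trunc \<alpha> (length s)" if "Inl s \<in> D" for s
    proof (rule nth_equalityI)
      fix i assume "i < length s"
      then show "s ! i = trunc \<alpha> (length s) ! i"
        using agree[OF that w(1)[of "Suc i"]] w(2)[of "Suc i"] by (simp add: \<alpha>_def)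
    qed simp
    show thesis
    proof (rule branch)
      show "D \<subseteq> range (\<lambda>n. Inl (trunc \<alpha> n))"
        using words eq by fast
      show "\<forall>n. \<exists>k\<ge>n. Inl (trunc \<alpha> k) \<in> D"
        using unb eq by metis
    qed
  qed
qed

lemma dcpo_bin_poset: "dcpo bin_poset"
  unfolding dcpo_def
proof (intro conjI allI impI)
  fix D assume D: "directed_in bin_poset D"
  then show "\<exists>x. is_lub bin_poset x D"
  proof (cases rule: directed_cases)
    case (greatest p)
    then show ?thesis using D is_lub_greatest unfolding directed_in_def by blast
  next
    case (branch \<alpha>)
    then show ?thesis using is_lub_truncs by blast
  qed
qed (rule partial_order_bin_poset)

section \<open>Finite approximations\<close>

lemma up_set_bin_poset: "up_set bin_poset A = {p \<in> carrier bin_poset. \<exists>a\<in>A. bin_le a p}"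
  by (simp add: up_set_def)

text \<open>Each point above \<open>x\<close> is the supremum of its own singleton, which must then
  meet the up-set of \<open>F\<close>.\<close>

lemma up_set_subset_if_way_below:
  assumes "way_below bin_poset F x"
  shows "up_set bin_poset {x} \<subseteq> up_set bin_poset F"
proof
  fix y assume y: "y \<in> up_set bin_poset {x}"
  then have "y \<in> carrier bin_poset" by (simp add: up_set_def)
  then have "directed_in bin_poset {y}" "is_lub bin_poset y {y}"
    by (auto intro: directed_singleton is_lub_greatest simp del: bin_poset_sel(1))
  then have "{y} \<inter> up_set bin_poset F \<noteq> {}"
    using assms y unfolding way_below_def by blast
  then show "y \<in> up_set bin_poset F" by blast
qed

text \<open>A word \<open>x\<close> is itself included because a word above it may be shorter than
  \<open>n\<close>. The sequences \<alpha> are constrained only by their value, so an expansion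
  counts even if it does not pass through the word \<open>x\<close>; at dyadic rationals this brings
  in both expansions.\<close>

definition approx :: "nat \<Rightarrow> bool list + real \<Rightarrow> (bool list + real) set" where
  "approx n x = {x} \<inter> range Inl \<union> {Inl (trunc \<alpha> n) | \<alpha>. bin_le x (Inr (bin_val \<alpha>))}"

lemma finite_approx: "finite (approx n x)"
proof (rule finite_subset)
  show "approx n x \<subseteq> {x} \<union> Inl ` {s. set s \<subseteq> UNIV \<and> length s = n}"
    by (auto simp: approx_def)
  show "finite ({x} \<union> Inl ` {s :: bool list. set s \<subseteq> UNIV \<and> length s = n})"
    using finite_lists_length_eq[of "UNIV :: bool set" n] by simp
qed

lemma approx_carrier: "approx n x \<subseteq> carrier bin_poset"
  by (auto simp: approx_def)

text \<open>A greatest element of \<open>D\<close> is its supremum, so it suffices to find an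
  element of \<open>approx n x\<close> below it. Otherwise \<open>D\<close> follows one sequence
  \<alpha> whose value is above \<open>x\<close>, and \<open>D\<close> contains an extension of
  \<open>trunc \<alpha> n\<close>.\<close>

lemma way_below_approx: "way_below bin_poset (approx n x) x"
  unfolding way_below_def
proof (intro allI impI, elim conjE)
  fix D p
  assume D: "directed_in bin_poset D" and p: "is_lub bin_poset p D"
    and "p \<in> up_set bin_poset {x}"
  then have "bin_le x p" and car: "D \<subseteq> carrier bin_poset"
    by (simp_all add: up_set_def directed_in_def)
  from D show "D \<inter> up_set bin_poset (approx n x) \<noteq> {}"
  proof (cases rule: directed_cases)
    case (greatest q)
    then have "p = q" using p car is_lub_greatest is_lub_bin_poset_unique by blast
    have "\<exists>a\<in>approx n x. bin_le a p"
    proof (cases p)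
      case (Inl t)
      then have "x \<in> range Inl" using \<open>bin_le x p\<close> by (cases x) auto
      then show ?thesis using \<open>bin_le x p\<close> by (auto simp: approx_def)
    next
      case (Inr r)
      then have "r \<in> {0..1}" using car greatest \<open>p = q\<close> by auto
      then obtain \<alpha> where "r = bin_val \<alpha>" using bin_val_surj by blast
      then have "Inl (trunc \<alpha> n) \<in> approx n x" "bin_le (Inl (trunc \<alpha> n)) p"
        using Inr \<open>bin_le x p\<close> by (auto simp: approx_def)
      then show ?thesis by blast
    qed
    then show ?thesis using greatest \<open>p = q\<close> car unfolding up_set_bin_poset by blast
  next
    case (branch \<alpha>)
    then have "p = Inr (bin_val \<alpha>)" using p is_lub_truncs is_lub_bin_poset_unique by blast
    then have "Inl (trunc \<alpha> n) \<in> approx n x" using \<open>bin_le x p\<close> by (auto simp: approx_def)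
    moreover obtain k where "k \<ge> n" "Inl (trunc \<alpha> k) \<in> D" using branch by blast
    moreover have "bin_le (Inl (trunc \<alpha> n)) (Inl (trunc \<alpha> k))"
      using \<open>k \<ge> n\<close> prefix_trunc_trunc by simp
    ultimately show ?thesis using car unfolding up_set_bin_poset by blast
  qed
qed

text \<open>The truncations of \<alpha> form a chain with supremum \<open>bin_val \<alpha>\<close>,
  so some element of \<open>F\<close> lies below one of them; only a prefix, again a truncation of
  \<alpha>, can do so.\<close>

lemma way_below_contains_truncation:
  assumes "way_below bin_poset F x" and "bin_le x (Inr (bin_val \<alpha>))"
  obtains k where "Inl (trunc \<alpha> k) \<in> F"
proof -
  let ?D = "range (\<lambda>n. Inl (trunc \<alpha> n)) :: (bool list + real) set"
  have "directed_in bin_poset ?D"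
    unfolding directed_in_def
  proof (intro conjI ballI)
    fix x y assume "x \<in> ?D" "y \<in> ?D"
    then obtain m n where "x = Inl (trunc \<alpha> m)" "y = Inl (trunc \<alpha> n)" by auto
    then have "bin_le x (Inl (trunc \<alpha> (max m n)))" "bin_le y (Inl (trunc \<alpha> (max m n)))"
      by (simp_all add: prefix_trunc_trunc)
    then show "\<exists>z\<in>?D. x \<sqsubseteq>\<^bsub>bin_poset\<^esub> z \<and> y \<sqsubseteq>\<^bsub>bin_poset\<^esub> z" by auto
  qed auto
  moreover have "is_lub bin_poset (Inr (bin_val \<alpha>)) ?D"
    by (rule is_lub_truncs) auto
  moreover have "Inr (bin_val \<alpha>) \<in> up_set bin_poset {x}"
    using assms(2) bin_val_carrier unfolding up_set_bin_poset by blast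
  ultimately have "?D \<inter> up_set bin_poset F \<noteq> {}"
    using assms(1) unfolding way_below_def by blast
  then obtain n f where f: "f \<in> F" "bin_le f (Inl (trunc \<alpha> n))"
    by (auto simp: up_set_def)
  then obtain s where s: "f = Inl s" "prefix s (trunc \<alpha> n)" by (cases f) auto
  then have "s = trunc \<alpha> (length s)"
    by (intro nth_equalityI) (auto simp: prefix_iff_nth)
  then show thesis using that f s by metis
qed

text \<open>Once \<open>n\<close> bounds the lengths of all words in \<open>F\<close>, the
  truncation of \<alpha> that \<open>F\<close> contains is a prefix of
  \<open>trunc \<alpha> n\<close>. Stating this for all large \<open>n\<close> lets two sets
  \<open>F\<close> share one index.\<close>

lemma approx_eventually_in_up_set:
  assumes x: "x \<in> carrier bin_poset" and F: "finite F" "way_below bin_poset F x"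
  shows "\<forall>\<^sub>F n in sequentially. approx n x \<subseteq> up_set bin_poset F"
proof -
  have "finite (Inl -` F)"
    using F(1) by (intro finite_vimageI) auto
  then obtain N where N: "length s \<le> N" if "Inl s \<in> F" for s
    using finite_nat_set_iff_bounded_le[of "length ` (Inl -` F)"] by auto
  have "a \<in> up_set bin_poset F" if "n \<ge> N" and a: "a \<in> approx n x" for n a
  proof (cases "a = x")
    case True
    then have "a \<in> up_set bin_poset {x}" using x by (simp add: up_set_def)
    then show ?thesis using up_set_subset_if_way_below[OF F(2)] by blast
  next
    case False
    then obtain \<alpha> where \<alpha>: "a = Inl (trunc \<alpha> n)" "bin_le x (Inr (bin_val \<alpha>))"
      using a by (auto simp: approx_def)
    obtain k where k: "Inl (trunc \<alpha> k) \<in> F"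
      using way_below_contains_truncation[OF F(2) \<alpha>(2)] .
    then have "k \<le> n" using N[OF k] \<open>n \<ge> N\<close> by simp
    then have "bin_le (Inl (trunc \<alpha> k)) a" using \<alpha>(1) by (simp add: prefix_trunc_trunc)
    then show ?thesis using k approx_carrier a unfolding up_set_bin_poset by blast
  qed
  then show ?thesis by (auto simp: eventually_sequentially)
qed

lemma Inter_up_set_approx:
  "(\<Inter>n. up_set bin_poset (approx n x)) \<subseteq> up_set bin_poset {x}"
proof
  fix y assume y: "y \<in> (\<Inter>n. up_set bin_poset (approx n x))"
  then have car: "y \<in> carrier bin_poset" by (simp add: up_set_def)
  have "bin_le x y"
  proof (rule ccontr)
    assume not_le: "\<not> bin_le x y"
    have *: "\<exists>\<alpha>. bin_le x (Inr (bin_val \<alpha>)) \<and> bin_le (Inl (trunc \<alpha> n)) y" for n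
    proof -
      \<comment> \<open>The element found below \<open>y\<close> cannot be \<open>x\<close> itself,
        so it is a truncation.\<close>
      have "\<exists>a\<in>approx n x. bin_le a y" using y by (simp add: up_set_def)
      then show ?thesis using not_le by (auto simp: approx_def)
    qed
    show False
    proof (cases y)
      case (Inl t)
      then obtain \<alpha> where "prefix (trunc \<alpha> (Suc (length t))) t"
        using *[of "Suc (length t)"] by auto
      then show False by (auto dest: prefix_length_le)
    next
      case (Inr q)
      let ?R = "{r. bin_le x (Inr r)}"
      \<comment> \<open>For a word \<open>x\<close> this set is the image of a cylinder, for a real
        a single point. Closedness turns approximation of \<open>q\<close> by points above
        \<open>x\<close> into membership.\<close>
      have "closed ?R"
        using closed_bin_val_image_cylinder by (cases x) auto
      moreover have "\<exists>r\<in>?R. dist r q < e" if "e > 0" for e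
      proof -
        obtain n where n: "1 / 2 ^ n < e" using half_power_less[OF \<open>e > 0\<close>] by blast
        obtain \<alpha> where \<alpha>: "bin_le x (Inr (bin_val \<alpha>))" "bin_le (Inl (trunc \<alpha> n)) y"
          using *[of n] by blast
        then obtain \<beta> where "\<beta> \<in> cylinder (trunc \<alpha> n)" "q = bin_val \<beta>" using Inr by auto
        then have "dist (bin_val \<alpha>) q \<le> 1 / 2 ^ n"
          using bin_val_cylinder_dist[of \<alpha> "trunc \<alpha> n" \<beta>] by (simp add: dist_real_def)
        then show ?thesis using \<alpha>(1) n by force
      qed
      ultimately have "q \<in> ?R"
        unfolding closed_def open_dist by (metis ComplD ComplI)
      then show False using not_le Inr by simp
    qed
  qed
  then show "y \<in> up_set bin_poset {x}" using car unfolding up_set_bin_poset by blast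
qed

theorem theorem3p12:
  shows "quasicontinuous_dcpo bin_poset"
  unfolding quasicontinuous_dcpo_def
proof (intro conjI ballI dcpo_bin_poset)
  fix x assume x: "x \<in> carrier bin_poset"
  have mem: "up_set bin_poset (approx n x) \<in> fin_way_below bin_poset x" for n
    using finite_approx approx_carrier way_below_approx unfolding fin_way_below_def by blast
  have up: "up_set bin_poset A \<subseteq> up_set bin_poset F" if "A \<subseteq> up_set bin_poset F" for A F
    using that bin_le_trans unfolding up_set_bin_poset by blast
  show "filtered_family (fin_way_below bin_poset x)"
    unfolding filtered_family_def
  proof (intro conjI ballI)
    show "fin_way_below bin_poset x \<noteq> {}" using mem by blast
  next
    fix A B assume "A \<in> fin_way_below bin_poset x" "B \<in> fin_way_below bin_poset x"
    then obtain F G where FG: "A = up_set bin_poset F" "finite F" "way_below bin_poset F x"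
      "B = up_set bin_poset G" "finite G" "way_below bin_poset G x"
      unfolding fin_way_below_def by blast
    \<comment> \<open>One sufficiently large \<open>n\<close> serves both members of the family, so
      the approximations witness filteredness.\<close>
    have "\<forall>\<^sub>F n in sequentially. approx n x \<subseteq> A \<and> approx n x \<subseteq> B"
      using FG x by (intro eventually_conj) (simp_all only: approx_eventually_in_up_set)
    then obtain n where "approx n x \<subseteq> A" "approx n x \<subseteq> B"
      by (auto simp: eventually_sequentially)
    then have "up_set bin_poset (approx n x) \<subseteq> A \<inter> B" using up FG by blast
    then show "\<exists>C\<in>fin_way_below bin_poset x. C \<subseteq> A \<inter> B" using mem by blast
  qed
  show "\<Inter> (fin_way_below bin_poset x) = up_set bin_poset {x}"
  proof
    show "\<Inter> (fin_way_below bin_poset x) \<subseteq> up_set bin_poset {x}"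
      using mem Inter_up_set_approx[of x] by blast
    show "up_set bin_poset {x} \<subseteq> \<Inter> (fin_way_below bin_poset x)"
      using up_set_subset_if_way_below unfolding fin_way_below_def by blast
  qed
qed

end
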